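(* Let $a\in\mathbb{R}$ and let $$f(x)=\begin{cases}0, & -1\le x<0,\\ -ax, & 0\le x\le 1.\end{cases}$$ Let $\{X_n^\varepsilon\}_{n\ge 0}$ be the process defined by $X_0^\varepsilon=0$ and $X_{n+1}^\varepsilon=f(X_n^\varepsilon)+\varepsilon\xi_{n+1}$, and let $\tau=\min\{n\ge 1:|X_n^\varepsilon|\ge 1\}$. Then $$\limsup_{\varepsilon\to 0}\varepsilon^2\log E\tau\le\frac12\cdot\frac{1}{1+a^2}.$$
   Context: Here $\varepsilon>0$ is a small parameter tending to $0$ and $\{\xi_n\}_{n\ge 1}$ is an i.i.d. sequence of standard normal random variables. The function $f$ is specified on $[-1,1]$ and may be extended to a continuous function on $\mathbb{R}$ arbitrarily; only its values on $[-1,1]$ affect the exit time $\tau$. *)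

theory Defs
  imports "HOL-Probability.Probability"
begin

primrec chain :: "(real \<Rightarrow> real) \<Rightarrow> (nat \<Rightarrow> 'a \<Rightarrow> real) \<Rightarrow> real \<Rightarrow> nat \<Rightarrow> 'a \<Rightarrow> real" where
  "chain f \<xi> \<epsilon> 0 \<omega> = 0"
| "chain f \<xi> \<epsilon> (Suc n) \<omega> = f (chain f \<xi> \<epsilon> n \<omega>) + \<epsilon> * \<xi> (Suc n) \<omega>"

(* The infimum in enat is the minimum of a nonempty set, and is infinity on paths that never exit. *)
definition exit_time :: "(nat \<Rightarrow> 'a \<Rightarrow> real) \<Rightarrow> 'a \<Rightarrow> enat" where
  "exit_time X \<omega> = Inf {enat n | n. 1 \<le> n \<and> \<bar>X n \<omega>\<bar> \<ge> 1}"

(* Extended-valued, so that an infinite expected exit time would give the logarithm infinity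
   rather than a junk real value. *)
definition ln_ennreal :: "ennreal \<Rightarrow> ereal" where
  "ln_ennreal x =
     (if x = 0 then -\<infinity> else if x = \<infinity> then \<infinity> else ereal (ln (enn2real x)))"

end

theory Submission
  imports Defs
begin

(* For small noise the cheapest exit uses two large innovations: a push to y = |a| / (1 + a^2)
   followed by a push of size z = 1 / (1 + a^2) in the direction of f y, which reaches the boundary
   because |a| y + z = 1; its cost is (y^2 + z^2) / 2 = 1 / (2 (1 + a^2)).  A preliminary
   nonpositive innovation, of constant probability, makes the recipe work from every state
   inside (-1, 1).  Hence the exit occurs no later than the first of the independent blocks of
   three innovations which follow the recipe, and its expected time is at most 3 / p, where p is
   the probability of the recipe. *)

section \<open>Bounds for the extended logarithm and the exit time\<close>

lemma ln_ennreal_le: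
  assumes "x \<le> ennreal r" "0 < r"
  shows "ln_ennreal x \<le> ereal (ln r)"
proof (cases x)
  case (real s)
  then show ?thesis
    using assms by (auto simp: ln_ennreal_def)
next
  case top
  then show ?thesis
    using assms by (simp add: top_unique)
qed

lemma exit_time_le:
  assumes "1 \<le> n" "\<bar>X n \<omega>\<bar> \<ge> 1"
  shows "exit_time X \<omega> \<le> enat n"
  unfolding exit_time_def using assms by (auto intro!: Inf_lower)

section \<open>Gaussian lower bounds and geometric waiting times\<close>

text \<open>The density decreases in \<open>\<bar>x\<bar>\<close>, so it is at least its value at
  \<open>r\<close> on the interval, whose length 1 leaves no extra factor. Applied with
  \<open>r\<close> one unit beyond a threshold, this crude tail bound keeps the right exponential
  rate.\<close>

lemma (in prob_space) std_normal_density_le_prob: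
  assumes X: "distributed M lborel X std_normal_density"
    and S: "S \<in> sets borel" "{u..u + 1} \<subseteq> S"
    and r: "\<And>x. x \<in> {u..u + 1} \<Longrightarrow> \<bar>x\<bar> \<le> r"
  shows "std_normal_density r \<le> prob (X -` S \<inter> space M)"
proof -
  have dens: "std_normal_density r \<le> std_normal_density x" if "x \<in> {u..u + 1}" for x
  proof -
    have "x\<^sup>2 \<le> r\<^sup>2"
      using r[OF that] by (simp add: abs_le_square_iff[symmetric])
    then show ?thesis
      by (auto simp: normal_density_def divide_right_mono)
  qed
  have "ennreal (std_normal_density r) = (\<integral>\<^sup>+x. ennreal (std_normal_density r) * indicator {u..u + 1} x \<partial>lborel)"
    by (simp add: nn_integral_cmult_indicator)
  also have "\<dots> \<le> (\<integral>\<^sup>+x. ennreal (std_normal_density x) * indicator S x \<partial>lborel)"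
    using S(2) dens by (intro nn_integral_mono) (auto simp: indicator_def intro!: ennreal_leI)
  also have "\<dots> = emeasure M (X -` S \<inter> space M)"
    using S by (intro distributed_emeasure[OF X, symmetric]) auto
  finally show ?thesis
    by (simp add: emeasure_eq_measure)
qed

text \<open>Comparison with a geometric waiting time: \<open>T\<close> is at most \<open>m\<close>
  times the number of trials up to the first success. That number is the sum of the indicators of
  "no success before trial \<open>k\<close>"; by independence these events have probability at most
  \<open>(1 - p) ^ k\<close>, and the geometric series sums to \<open>1 / p\<close>.\<close>

lemma (in prob_space) nn_integral_le_of_first_success:
  fixes T :: "'a \<Rightarrow> ennreal"
  assumes Y: "indep_vars N Y (UNIV :: nat set)"
    and S: "\<And>k. S k \<in> sets (N k)"
    and p: "\<And>k. p \<le> prob (Y k -` S k \<inter> space M)" "0 < p"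
    and m: "0 < m"
    and T: "\<And>k \<omega>. \<omega> \<in> space M \<Longrightarrow> Y k \<omega> \<in> S k \<Longrightarrow> T \<omega> \<le> of_nat (m * Suc k)"
  shows "(\<integral>\<^sup>+\<omega>. T \<omega> \<partial>M) \<le> ennreal (real m / p)"
proof -
  have Ym [measurable]: "Y k \<in> measurable M (N k)" for k
    using Y by (simp add: indep_vars_def)
  note S [measurable]
  define F where "F k = {\<omega> \<in> space M. \<forall>j<k. Y j \<omega> \<notin> S j}" for k
  have F [measurable]: "F k \<in> sets M" for k
    unfolding F_def by measurable
  have p1: "p \<le> 1"
    using p(1)[of 0] prob_le_1 by (rule order_trans)
  have prob_F: "prob (F k) \<le> (1 - p) ^ k" for k
  proof (cases "k = 0")
    case False
    \<comment> \<open>The product rule for independence needs a nonempty index set, hence the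
      separate case \<open>k = 0\<close>.\<close>
    have "F k = (\<Inter>j\<in>{..<k}. Y j -` (space (N j) - S j) \<inter> space M)"
      using False by (auto simp: F_def dest: measurable_space[OF Ym])
    also have "prob \<dots> = (\<Prod>j<k. prob (Y j -` (space (N j) - S j) \<inter> space M))"
      using False by (intro indep_varsD[OF Y]) auto
    also have "\<dots> \<le> (\<Prod>j<k. 1 - p)"
    proof (intro prod_mono conjI)
      fix j
      have "Y j -` (space (N j) - S j) \<inter> space M = space M - (Y j -` S j \<inter> space M)"
        by (auto dest: measurable_space[OF Ym])
      then show "prob (Y j -` (space (N j) - S j) \<inter> space M) \<le> 1 - p"
        using p(1)[of j] by (simp add: prob_compl measurable_sets[OF Ym S])
    qed simp
    finally show ?thesis
      by simp
  qed simp
  have T_le: "T \<omega> \<le> of_nat m * (\<Sum>k. indicator (F k) \<omega>)" if \<omega>: "\<omega> \<in> space M" for \<omega>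
  proof (cases "\<exists>k. Y k \<omega> \<in> S k")
    case True
    define k where "k = (LEAST k. Y k \<omega> \<in> S k)"
    have k: "Y k \<omega> \<in> S k" "\<And>j. j < k \<Longrightarrow> Y j \<omega> \<notin> S j"
      using True unfolding k_def by (auto intro: LeastI_ex dest: not_less_Least)
    \<comment> \<open>\<open>F j\<close> forbids successes strictly before \<open>j\<close>, so
      \<open>F 0\<close>, ..., \<open>F k\<close> all contain \<open>\<omega>\<close>, which gives
      \<open>Suc k\<close> terms.\<close>
    have "of_nat (Suc k) = (\<Sum>j<Suc k. indicator (F j) \<omega> :: ennreal)"
      using \<omega> k(2) by (simp add: F_def)
    also have "\<dots> \<le> (\<Sum>j. indicator (F j) \<omega>)"
      by (rule sum_le_suminf) auto
    finally have "of_nat m * of_nat (Suc k) \<le> of_nat m * (\<Sum>j. indicator (F j) \<omega> :: ennreal)"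
      by (rule mult_left_mono) simp
    then show ?thesis
      using T[OF \<omega> k(1)] by (metis of_nat_mult order_trans)
  next
    \<comment> \<open>On a path without any success every \<open>F k\<close> occurs and the sum is
      infinite, so the bound holds there whatever \<open>T\<close> is.\<close>
    case False
    then have one: "indicator (F k) \<omega> = (1 :: ennreal)" for k
      using \<omega> by (simp add: F_def)
    have "r < (\<Sum>k. indicator (F k) \<omega> :: ennreal)" if r: "r < \<top>" for r
    proof -
      obtain n where "r < of_nat n"
        using r ennreal_Ex_less_of_nat by auto
      also have "\<dots> = (\<Sum>k<n. indicator (F k) \<omega> :: ennreal)"
        by (simp add: one)
      also have "\<dots> \<le> (\<Sum>k. indicator (F k) \<omega>)"
        by (rule sum_le_suminf) auto
      finally show ?thesis .
    qed
    then have "(\<Sum>k. indicator (F k) \<omega> :: ennreal) = \<top>"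
      using top.not_eq_extremum by blast
    then show ?thesis
      using m by (simp add: ennreal_mult_top)
  qed
  have "(\<integral>\<^sup>+\<omega>. T \<omega> \<partial>M) \<le> (\<integral>\<^sup>+\<omega>. of_nat m * (\<Sum>k. indicator (F k) \<omega>) \<partial>M)"
    by (rule nn_integral_mono) (rule T_le)
  also have "\<dots> = of_nat m * (\<Sum>k. emeasure M (F k))"
    by (simp add: nn_integral_cmult nn_integral_suminf)
  also have "\<dots> \<le> of_nat m * (\<Sum>k. ennreal ((1 - p) ^ k))"
    using prob_F by (intro mult_left_mono suminf_le) (auto simp: emeasure_eq_measure intro!: ennreal_leI)
  also have "(\<Sum>k. ennreal ((1 - p) ^ k)) = ennreal (1 / p)"
    using geometric_sums[of "1 - p"] p1 p(2) by (intro suminf_ennreal_eq) auto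
  also have "of_nat m * ennreal (1 / p) = ennreal (real m / p)"
    using p(2) by (simp add: ennreal_of_nat_eq_real_of_nat ennreal_mult'[symmetric])
  finally show ?thesis .
qed

section \<open>From a favourable noise block to the expected exit time\<close>

text \<open>If no exit has occurred by the end of the block, all its states lie in (-1, 1), where
  \<open>f\<close> is known. The second innovation then leads to a state of at least
  \<open>y\<close>, and the third adds \<open>z\<close> in the direction of the drift, giving
  modulus at least \<open>\<bar>a\<bar> * y + z = 1\<close>.\<close>

lemma exit_time_le_of_noise_block:
  fixes a y z \<epsilon> :: real
  assumes f: "\<And>x. -1 \<le> x \<Longrightarrow> x < 0 \<Longrightarrow> f x = 0" "\<And>x. 0 \<le> x \<Longrightarrow> x \<le> 1 \<Longrightarrow> f x = - a * x"
    and yz: "0 \<le> y" "\<bar>a\<bar> * y + z = 1"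
    and eps: "0 < \<epsilon>"
    and \<xi>: "\<xi> (3 * k + 1) \<omega> \<le> 0" "y \<le> \<epsilon> * \<xi> (3 * k + 2) \<omega>"
      "if 0 \<le> a then \<epsilon> * \<xi> (3 * k + 3) \<omega> \<le> - z else z \<le> \<epsilon> * \<xi> (3 * k + 3) \<omega>"
  shows "exit_time (chain f \<xi> \<epsilon>) \<omega> \<le> enat (3 * Suc k)"
proof (rule ccontr)
  assume late: "\<not> ?thesis"
  let ?X = "\<lambda>n. chain f \<xi> \<epsilon> n \<omega>"
  have inside: "\<bar>?X n\<bar> < 1" if "n \<le> 3 * k + 3" for n
  \<comment> \<open>The exit time only looks at times from 1 on; at time 0 the chain starts at 0,
    which is inside.\<close>
  proof (cases "n = 0")
    case False
    show ?thesis
    proof (rule ccontr)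
      assume "\<not> ?thesis"
      then have "exit_time (chain f \<xi> \<epsilon>) \<omega> \<le> enat n"
        using False by (intro exit_time_le) auto
      also have "\<dots> \<le> enat (3 * Suc k)"
        using that by simp
      finally show False
        using late by simp
    qed
  qed simp
  have X1: "?X (3 * k + 1) = f (?X (3 * k)) + \<epsilon> * \<xi> (3 * k + 1) \<omega>"
    and X2: "?X (3 * k + 2) = f (?X (3 * k + 1)) + \<epsilon> * \<xi> (3 * k + 2) \<omega>"
    and X3: "?X (3 * k + 3) = f (?X (3 * k + 2)) + \<epsilon> * \<xi> (3 * k + 3) \<omega>"
    by (simp_all add: numeral_eq_Suc)
  have in0: "\<bar>?X (3 * k)\<bar> < 1" and in1: "\<bar>?X (3 * k + 1)\<bar> < 1"
    and in2: "\<bar>?X (3 * k + 2)\<bar> < 1" and in3: "\<bar>?X (3 * k + 3)\<bar> < 1"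
    by (simp_all add: inside del: chain.simps)
  show False
  proof (cases "0 \<le> a")
    case True
    \<comment> \<open>For \<open>a\<close> nonnegative the drift never points up, so a nonpositive
      first innovation makes the state nonpositive, where \<open>f\<close> vanishes; the second push
      then starts from 0.\<close>
    have f_le: "f x \<le> 0" if "\<bar>x\<bar> < 1" for x
      using f[of x] that True by (cases "x < 0") auto
    have "\<epsilon> * \<xi> (3 * k + 1) \<omega> \<le> 0"
      using eps \<xi>(1) by (simp add: mult_nonneg_nonpos)
    then have "?X (3 * k + 1) \<le> 0"
      using X1 f_le[OF in0] by linarith
    then have "f (?X (3 * k + 1)) = 0"
      using f[of "?X (3 * k + 1)"] in1 by (cases "?X (3 * k + 1) < 0") auto
    then have y: "y \<le> ?X (3 * k + 2)"
      using X2 \<xi>(2) by linarith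
    then have "f (?X (3 * k + 2)) = - a * ?X (3 * k + 2)"
      using f(2) in2 yz(1) by auto
    moreover have "a * y \<le> a * ?X (3 * k + 2)"
      using y True by (rule mult_left_mono)
    ultimately show False
      using X3 \<xi>(3) yz(2) in3 True by (simp del: chain.simps)
  next
    case False
    \<comment> \<open>For \<open>a\<close> negative the drift never points down, so the second push
      lifts the state to at least \<open>y\<close> from any state inside.\<close>
    have f_ge: "0 \<le> f x" if "\<bar>x\<bar> < 1" for x
      using f[of x] that False by (cases "x < 0") (auto simp: mult_le_0_iff)
    have y: "y \<le> ?X (3 * k + 2)"
      using X2 \<xi>(2) f_ge[OF in1] by linarith
    then have "f (?X (3 * k + 2)) = - a * ?X (3 * k + 2)"
      using f(2) in2 yz(1) by auto
    moreover have "a * ?X (3 * k + 2) \<le> a * y"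
      using y False by (intro mult_left_mono_neg) auto
    moreover have "z \<le> \<epsilon> * \<xi> (3 * k + 3) \<omega>" "z - a * y = 1"
      using \<xi>(3) yz(2) False by auto
    ultimately show False
      using X3 in3 by linarith
  qed
qed

text \<open>Each block of three innovations is one trial, and success means that it follows the
  recipe. The denominator bounds the success probability below, one density value per
  innovation.\<close>

lemma (in prob_space) expected_exit_time_le:
  fixes a y z \<epsilon> :: real
  assumes indep: "indep_vars (\<lambda>_. borel) \<xi> {1..}"
    and normal: "\<And>n. n \<ge> 1 \<Longrightarrow> distributed M lborel (\<xi> n) std_normal_density"
    and f: "\<And>x. -1 \<le> x \<Longrightarrow> x < 0 \<Longrightarrow> f x = 0" "\<And>x. 0 \<le> x \<Longrightarrow> x \<le> 1 \<Longrightarrow> f x = - a * x"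
    and yz: "0 \<le> y" "0 \<le> z" "\<bar>a\<bar> * y + z = 1"
    and eps: "0 < \<epsilon>"
  shows "(\<integral>\<^sup>+\<omega>. ennreal_of_enat (exit_time (chain f \<xi> \<epsilon>) \<omega>) \<partial>M)
    \<le> ennreal (3 / (std_normal_density 1 * std_normal_density (y / \<epsilon> + 1) * std_normal_density (z / \<epsilon> + 1)))"
proof -
  \<comment> \<open>Innovations are numbered from 1, so blocks start at \<open>3 * k + 1\<close> and
    residue 0 modulo 3 marks the third innovation of a block.\<close>
  define K where "K k = {3 * k + 1, 3 * k + 2, 3 * k + 3}" for k :: nat
  define B where "B i = (if i mod 3 = 1 then {..0} else if i mod 3 = 2 then {y / \<epsilon>..}
    else if 0 \<le> a then {..- (z / \<epsilon>)} else {z / \<epsilon>..})" for i :: nat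
  define Y where "Y k \<omega> = restrict (\<lambda>i. \<xi> i \<omega>) (K k)" for k \<omega>
  define S where "S k = Pi\<^sub>E (K k) B" for k
  have B: "B i \<in> sets borel" for i
    by (simp add: B_def)
  have B_block: "B (3 * k + 1) = {..0}" "B (3 * k + 2) = {y / \<epsilon>..}"
    "B (3 * k + 3) = (if 0 \<le> a then {..- (z / \<epsilon>)} else {z / \<epsilon>..})" for k
  proof -
    have "(3 * k + 1) mod 3 = 1" "(3 * k + 2) mod 3 = 2" "(3 * k + 3) mod 3 = 0"
      by presburger+
    then show "B (3 * k + 1) = {..0}" "B (3 * k + 2) = {y / \<epsilon>..}"
      "B (3 * k + 3) = (if 0 \<le> a then {..- (z / \<epsilon>)} else {z / \<epsilon>..})"
      by (simp_all only: B_def) simp_all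
  qed
  \<comment> \<open>Grouping an independent family along disjoint index sets yields independent
    random vectors.\<close>
  have iv: "indep_vars (\<lambda>k. PiM (K k) (\<lambda>_. borel)) Y UNIV"
    unfolding Y_def
  proof (rule indep_vars_restrict[OF indep])
    show "disjoint_family K"
      unfolding disjoint_family_on_def K_def by (auto; presburger)
  qed (auto simp: K_def)
  have "(\<integral>\<^sup>+\<omega>. ennreal_of_enat (exit_time (chain f \<xi> \<epsilon>) \<omega>) \<partial>M)
    \<le> ennreal (real 3 / (std_normal_density 1 * std_normal_density (y / \<epsilon> + 1) * std_normal_density (z / \<epsilon> + 1)))"
  proof (rule nn_integral_le_of_first_success[OF iv])
    show "S k \<in> sets (PiM (K k) (\<lambda>_. borel))" for k
      unfolding S_def using B by (intro sets_PiM_I_finite) (auto simp: K_def)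
  next
    fix k
    have tail: "std_normal_density r \<le> prob (\<xi> i -` B i \<inter> space M)"
      if "1 \<le> i" "{u..u + 1} \<subseteq> B i" "\<And>x. x \<in> {u..u + 1} \<Longrightarrow> \<bar>x\<bar> \<le> r" for i u r
      using that normal B by (intro std_normal_density_le_prob) auto
    have pos: "0 \<le> y / \<epsilon>" "0 \<le> z / \<epsilon>"
      using yz eps by auto
    have 1: "std_normal_density 1 \<le> prob (\<xi> (3 * k + 1) -` B (3 * k + 1) \<inter> space M)"
      by (rule tail[of _ "-1"]) (unfold B_block, auto)
    have 2: "std_normal_density (y / \<epsilon> + 1) \<le> prob (\<xi> (3 * k + 2) -` B (3 * k + 2) \<inter> space M)"
      using pos by (intro tail[of _ "y / \<epsilon>"]) (unfold B_block, auto)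
    \<comment> \<open>The unit interval adjoins the threshold on its outer side, to the left or
      right according to the sign of \<open>a\<close>; either way its points have modulus at most
      \<open>z / \<epsilon> + 1\<close>.\<close>
    have 3: "std_normal_density (z / \<epsilon> + 1) \<le> prob (\<xi> (3 * k + 3) -` B (3 * k + 3) \<inter> space M)"
      using pos
      by (intro tail[of _ "if 0 \<le> a then - (z / \<epsilon>) - 1 else z / \<epsilon>"]) (unfold B_block, auto split: if_splits)
    have "std_normal_density 1 * std_normal_density (y / \<epsilon> + 1) * std_normal_density (z / \<epsilon> + 1)
      \<le> (\<Prod>i\<in>K k. prob (\<xi> i -` B i \<inter> space M))"
      using mult_mono[OF mult_mono[OF 1 2] 3] by (simp add: K_def mult.assoc)
    also have "\<dots> = prob (\<Inter>i\<in>K k. \<xi> i -` B i \<inter> space M)"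
      using B by (intro indep_varsD[OF indep, symmetric]) (auto simp: K_def)
    also have "(\<Inter>i\<in>K k. \<xi> i -` B i \<inter> space M) = Y k -` S k \<inter> space M"
      by (auto simp: S_def Y_def K_def PiE_iff)
    finally show "std_normal_density 1 * std_normal_density (y / \<epsilon> + 1) * std_normal_density (z / \<epsilon> + 1)
      \<le> prob (Y k -` S k \<inter> space M)" .
  next
    fix k \<omega> assume "Y k \<omega> \<in> S k"
    then have in_B: "\<xi> i \<omega> \<in> B i" if "i \<in> K k" for i
      using that by (auto simp: S_def Y_def PiE_iff)
    have "\<xi> (3 * k + 1) \<omega> \<in> B (3 * k + 1)" "\<xi> (3 * k + 2) \<omega> \<in> B (3 * k + 2)"
      "\<xi> (3 * k + 3) \<omega> \<in> B (3 * k + 3)"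
      by (rule in_B, simp add: K_def)+
    then have "\<xi> (3 * k + 1) \<omega> \<le> 0" "y / \<epsilon> \<le> \<xi> (3 * k + 2) \<omega>"
      "if 0 \<le> a then \<xi> (3 * k + 3) \<omega> \<le> - (z / \<epsilon>) else z / \<epsilon> \<le> \<xi> (3 * k + 3) \<omega>"
      unfolding B_block by (auto split: if_splits)
    then have "\<xi> (3 * k + 1) \<omega> \<le> 0" "y \<le> \<epsilon> * \<xi> (3 * k + 2) \<omega>"
      "if 0 \<le> a then \<epsilon> * \<xi> (3 * k + 3) \<omega> \<le> - z else z \<le> \<epsilon> * \<xi> (3 * k + 3) \<omega>"
      using eps by (auto simp: field_simps split: if_splits)
    then have "exit_time (chain f \<xi> \<epsilon>) \<omega> \<le> enat (3 * Suc k)"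
      using f yz(1,3) eps by (intro exit_time_le_of_noise_block[where a = a and y = y and z = z]) simp_all
    then show "ennreal_of_enat (exit_time (chain f \<xi> \<epsilon>) \<omega>) \<le> of_nat (3 * Suc k)"
      by (metis ennreal_of_enat_enat ennreal_of_enat_le_iff)
  qed (simp_all add: normal_density_pos)
  then show ?thesis
    by simp
qed

section \<open>The small-noise limit\<close>

lemma ln_std_normal_density: "ln (std_normal_density x) = - x\<^sup>2 / 2 - ln (sqrt (2 * pi))"
  by (simp add: normal_density_def ln_mult ln_div)

theorem mainTheorem6:
  fixes M :: "'a measure" and \<xi> :: "nat \<Rightarrow> 'a \<Rightarrow> real"
    and a :: real and f :: "real \<Rightarrow> real"
  assumes "prob_space M"
    and "prob_space.indep_vars M (\<lambda>_. borel) \<xi> {1..}"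
    and "\<And>n. n \<ge> 1 \<Longrightarrow> distributed M lborel (\<xi> n) std_normal_density"
    and "continuous_on UNIV f"
    and "\<And>x. -1 \<le> x \<Longrightarrow> x < 0 \<Longrightarrow> f x = 0"
    and "\<And>x. 0 \<le> x \<Longrightarrow> x \<le> 1 \<Longrightarrow> f x = - a * x"
  shows "Limsup (at_right 0)
           (\<lambda>\<epsilon>::real. ereal (\<epsilon>\<^sup>2) *
              ln_ennreal (\<integral>\<^sup>+\<omega>. ennreal_of_enat (exit_time (chain f \<xi> \<epsilon>) \<omega>) \<partial>M))
         \<le> ereal (1 / 2 * (1 / (1 + a\<^sup>2)))"
proof -
  interpret prob_space M by fact
  \<comment> \<open>\<open>(y, z)\<close> is the foot of the perpendicular from the origin to the
    line \<open>\<bar>a\<bar> * y + z = 1\<close>, so it minimises the cost among all admissible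
    pairs of pushes.\<close>
  define y where "y = \<bar>a\<bar> / (1 + a\<^sup>2)"
  define z where "z = 1 / (1 + a\<^sup>2)"
  have pos: "0 < 1 + a\<^sup>2"
    by (simp add: add_pos_nonneg)
  have yz: "0 \<le> y" "0 \<le> z" "\<bar>a\<bar> * y + z = 1"
    using pos by (auto simp: y_def z_def add_divide_distrib[symmetric] power2_eq_square[symmetric] add.commute)
  have "y\<^sup>2 + z\<^sup>2 = (1 + a\<^sup>2) / (1 + a\<^sup>2)\<^sup>2"
    by (simp add: y_def z_def power_divide add_divide_distrib[symmetric] add.commute)
  then have cost: "y\<^sup>2 + z\<^sup>2 = 1 / (1 + a\<^sup>2)"
    using pos by (simp add: power2_eq_square)
  \<comment> \<open>\<open>C\<close> collects the terms of \<open>ln (3 / p)\<close> free of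
    \<open>\<epsilon>\<close>: the block length, three Gaussian normalisations, and 1/2 from the
    density at 1. Then \<open>g \<epsilon>\<close> is
    \<open>\<epsilon>\<^sup>2 * ln (3 / p)\<close>, with \<open>\<epsilon>\<^sup>2\<close> absorbed
    into the squares.\<close>
  define C where "C = ln 3 + 3 * ln (sqrt (2 * pi)) + 1 / 2"
  define g where "g \<epsilon> = \<epsilon>\<^sup>2 * C + ((y + \<epsilon>)\<^sup>2 + (z + \<epsilon>)\<^sup>2) / 2" for \<epsilon> :: real
  have bound: "ereal (\<epsilon>\<^sup>2) * ln_ennreal (\<integral>\<^sup>+\<omega>. ennreal_of_enat (exit_time (chain f \<xi> \<epsilon>) \<omega>) \<partial>M)
    \<le> ereal (g \<epsilon>)" if eps: "0 < \<epsilon>" for \<epsilon>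
  proof -
    define p where "p = std_normal_density 1 * std_normal_density (y / \<epsilon> + 1) * std_normal_density (z / \<epsilon> + 1)"
    have dpos: "0 < std_normal_density x" for x
      by (simp add: normal_density_pos)
    then have p: "0 < p"
      by (simp add: p_def)
    have "ln_ennreal (\<integral>\<^sup>+\<omega>. ennreal_of_enat (exit_time (chain f \<xi> \<epsilon>) \<omega>) \<partial>M) \<le> ereal (ln (3 / p))"
      using expected_exit_time_le[OF assms(2,3,5,6) yz eps] p
      by (intro ln_ennreal_le) (auto simp: p_def)
    then have "ereal (\<epsilon>\<^sup>2) * ln_ennreal (\<integral>\<^sup>+\<omega>. ennreal_of_enat (exit_time (chain f \<xi> \<epsilon>) \<omega>) \<partial>M)
      \<le> ereal (\<epsilon>\<^sup>2) * ereal (ln (3 / p))"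
      by (intro ereal_mult_left_mono) auto
    also have "ln (3 / p) = C + ((y / \<epsilon> + 1)\<^sup>2 + (z / \<epsilon> + 1)\<^sup>2) / 2"
      using p dpos unfolding p_def C_def
      by (simp add: ln_div ln_mult_pos ln_std_normal_density less_imp_neq[OF dpos, symmetric] add_divide_distrib)
    also have "ereal (\<epsilon>\<^sup>2) * ereal (C + ((y / \<epsilon> + 1)\<^sup>2 + (z / \<epsilon> + 1)\<^sup>2) / 2) = ereal (g \<epsilon>)"
      using eps by (simp add: g_def field_simps power2_eq_square)
    finally show ?thesis .
  qed
  \<comment> \<open>The constant \<open>C\<close> and the unit shifts of the thresholds disappear in
    the limit, leaving only the cost \<open>(y\<^sup>2 + z\<^sup>2) / 2\<close>.\<close>
  have "(g \<longlongrightarrow> 0\<^sup>2 * C + ((y + 0)\<^sup>2 + (z + 0)\<^sup>2) / 2) (at_right 0)"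
    unfolding g_def by (intro tendsto_intros) auto
  then have "((\<lambda>\<epsilon>. ereal (g \<epsilon>)) \<longlongrightarrow> ereal (1 / 2 * (1 / (1 + a\<^sup>2)))) (at_right 0)"
    by (simp add: cost mult.commute)
  then have "Limsup (at_right 0) (\<lambda>\<epsilon>. ereal (g \<epsilon>)) = ereal (1 / 2 * (1 / (1 + a\<^sup>2)))"
    by (intro lim_imp_Limsup) auto
  moreover have "Limsup (at_right 0)
      (\<lambda>\<epsilon>. ereal (\<epsilon>\<^sup>2) * ln_ennreal (\<integral>\<^sup>+\<omega>. ennreal_of_enat (exit_time (chain f \<xi> \<epsilon>) \<omega>) \<partial>M))
    \<le> Limsup (at_right 0) (\<lambda>\<epsilon>. ereal (g \<epsilon>))"
    using bound by (intro Limsup_mono) (auto simp: eventually_at_right_less intro: eventually_at_rightI[of 0 1])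
  ultimately show ?thesis
    by simp
qed

end
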